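(* For each positive integer $n$, let $C_n=([n],E)$ be the cycle with edges $i(i+1)$, $i\in[n]$, where $n+1:=1$. Then $$\mathrm{vol}(C_n)=\frac{E_{n-1}}{2\,((n-1)!)},$$ where $E_{n-1}$ is the $(n-1)$-st Euler number. Hence the generating function is $$\sum_{n\ge1}\mathrm{vol}(C_n)x^n=\frac{x(\sec x+\tan x)}{2}.$$
   Context: $[n]=\{1,\dots,n\}$. For a graph $G=(VG,EG)$, the graph polytope is $P(G)=\{x\in[0,1]^{VG} : x_i+x_j\le 1 \text{ for every edge } ij\in EG\}$, and $\mathrm{vol}(G)$ denotes the $|VG|$-dimensional volume (Lebesgue measure) of $P(G)$. Thus $P(C_n)=\{x\in[0,1]^n : x_i+x_{i+1}\le1,\ i=1,\dots,n\}$ with $x_{n+1}:=x_1$; in the degenerate cases $n=2$ this is the polytope of a single edge, and $n=1$ it is $\{x_1\in[0,1]: 2x_1\le1\}$. The Euler numbers $E_n$ are the Euler zigzag numbers: $E_0=1$ and, for $n\ge1$, $E_n$ is the number of permutations $a_1a_2\cdots a_n$ of $[n]$ with $a_1<a_2>a_3<a_4>\cdots$ ($E_0,E_1,E_2,\dots=1,1,1,2,5,16,\dots$). The generating function identity is an identity of power series in $x$ (Taylor expansion at $0$). *)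

theory Defs
  imports
    "HOL-Analysis.Analysis"
    "HOL-Analysis.FPS_Convergence"
    "HOL-Combinatorics.Permutations"
begin

text \<open>
  A graph is given by a vertex set \<open>V\<close> and a set \<open>E\<close> of unordered edges \<open>{i, j}\<close>.
  Since \<open>{i, i} = {i}\<close>, a loop is a singleton edge, and it imposes \<open>x i + x i \<le> 1\<close>.
  Points of $[0,1]^V$ are extensional functions on \<open>V\<close> (\<open>undefined\<close> outside \<open>V\<close>), as required by
  the space of the product measure \<^const>\<open>PiM\<close>.
\<close>

definition graph_polytope :: "'v set \<Rightarrow> 'v set set \<Rightarrow> ('v \<Rightarrow> real) set" where
  "graph_polytope V E =
     {x \<in> V \<rightarrow>\<^sub>E {0..1}. \<forall>i\<in>V. \<forall>j\<in>V. {i, j} \<in> E \<longrightarrow> x i + x j \<le> 1}"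

definition graph_vol :: "'v set \<Rightarrow> 'v set set \<Rightarrow> real" where
  "graph_vol V E = measure (\<Pi>\<^sub>M v\<in>V. lborel) (graph_polytope V E)"

text \<open>\<^const>\<open>measure\<close> is 0 on non-measurable sets; this does not occur for finite graphs.\<close>

lemma sets_graph_polytope:
  assumes "finite V"
  shows "graph_polytope V E \<in> sets (\<Pi>\<^sub>M v\<in>V. lborel)"
proof -
  let ?M = "\<Pi>\<^sub>M v\<in>V. (lborel :: real measure)"
  have eq: "graph_polytope V E =
    {x \<in> space ?M. (\<forall>i\<in>V. 0 \<le> x i \<and> x i \<le> 1) \<and>
       (\<forall>i\<in>V. \<forall>j\<in>V. {i, j} \<in> E \<longrightarrow> x i + x j \<le> 1)}"
    by (auto simp: graph_polytope_def space_PiM PiE_iff)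
  have [measurable]: "(\<lambda>x. x i) \<in> borel_measurable ?M" if "i \<in> V" for i
    using measurable_component_singleton[OF that, of "\<lambda>_. lborel :: real measure"] by simp
  have 1: "{x \<in> space ?M. 0 \<le> x i} \<in> sets ?M" "{x \<in> space ?M. x i \<le> 1} \<in> sets ?M"
    if [simp]: "i \<in> V" for i
    by measurable
  have 2: "{x \<in> space ?M. x i + x j \<le> 1} \<in> sets ?M" if [simp]: "i \<in> V" "j \<in> V" for i j
    by measurable
  show ?thesis
  proof (cases "V = {}")
    case True
    then show ?thesis
      by (simp add: graph_polytope_def sets_PiM_empty)
  next
    case False
    show ?thesis
      unfolding eq
      by (intro sets.sets_Collect_conj sets.sets_Collect_finite_All' sets.sets_Collect_imp
          sets.sets_Collect_const assms False 1 2)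
  qed
qed

definition cycle_edges :: "nat \<Rightarrow> nat set set" where
  "cycle_edges n = {{i, if i = n then 1 else i + 1} | i. i \<in> {1..n}}"

text \<open>
  \<open>C\<^sub>1\<close> is a single vertex with a loop and \<open>C\<^sub>2\<close> is a single edge (the edges \<open>{1, 2}\<close> and
  \<open>{2, 1}\<close> coincide).
\<close>

lemma graph_polytope_cycle:
  "graph_polytope {1..n} (cycle_edges n) =
     {x \<in> {1..n} \<rightarrow>\<^sub>E {0..1}. \<forall>i\<in>{1..n}. x i + x (if i = n then 1 else i + 1) \<le> 1}"
  (is "?L = ?R")
proof (intro equalityI subsetI)
  fix x assume x: "x \<in> ?L"
  have "x i + x (if i = n then 1 else i + 1) \<le> 1" if i: "i \<in> {1..n}" for i
  proof -
    have "(if i = n then 1 else i + 1) \<in> {1..n}"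
      using i by auto
    moreover have "{i, if i = n then 1 else i + 1} \<in> cycle_edges n"
      using i unfolding cycle_edges_def by blast
    ultimately show ?thesis
      using x i unfolding graph_polytope_def by blast
  qed
  with x show "x \<in> ?R"
    unfolding graph_polytope_def by blast
next
  fix x assume x: "x \<in> ?R"
  have "x i + x j \<le> 1" if "{i, j} \<in> cycle_edges n" for i j
  proof -
    obtain k where k: "k \<in> {1..n}" "{i, j} = {k, if k = n then 1 else k + 1}"
      using \<open>{i, j} \<in> cycle_edges n\<close> unfolding cycle_edges_def by blast
    have "x k + x (if k = n then 1 else k + 1) \<le> 1"
      using x k(1) by blast
    with k(2) show ?thesis
      unfolding doubleton_eq_iff by (metis add.commute)
  qed
  with x show "x \<in> ?L"
    unfolding graph_polytope_def by blast
qed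

text \<open>
  The word \<open>a\<^sub>1 a\<^sub>2 \<dots> a\<^sub>n\<close> is the map \<open>i \<mapsto> a\<^sub>i\<close> (the identity outside \<open>{1..n}\<close>);
  the condition is \<open>a\<^sub>1 < a\<^sub>2 > a\<^sub>3 < a\<^sub>4 > \<dots>\<close>.
\<close>

definition euler_zigzag :: "nat \<Rightarrow> nat" where
  "euler_zigzag n =
     card {a. a permutes {1..n} \<and>
       (\<forall>i\<in>{1..<n}. if odd i then a i < a (i + 1) else a i > a (i + 1))}"

lemma euler_zigzag_0: "euler_zigzag 0 = 1"
  by (simp add: euler_zigzag_def)

end

theory Submission
  imports Defs
begin

text \<open>
  Cut the polytope of \<open>C\<^sub>n\<close> according to which coordinate is minimal. By rotation the \<open>n\<close> pieces have equal
  volume. If the minimal coordinate is \<open>m \<le> 1/2\<close>, the others range over a copy, scaled by \<open>1 - 2m\<close>,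
  of the polytope of the path on \<open>n - 1\<close> vertices; so the volume is \<open>n\<close> times the integral of
  \<open>(1 - 2m)\<^sup>n\<^sup>-\<^sup>1\<close> over \<open>[0, 1/2]\<close>, i.e. half that of the path. (These pieces are the pyramids with
  apex \<open>(1/2, \<dots>, 1/2)\<close> over the facets \<open>x i = 0\<close>.) The generating function of the path volumes is
  \<open>sec + tan\<close>, by integrating over one coordinate at a time; flipping every other coordinate identifies
  the path polytope, up to a null set, with the \<open>euler_zigzag\<close> many order simplices of alternating
  permutations, each of volume \<open>1 / k!\<close>.
\<close>

unbundle no vec_syntax and fps_syntax

declare One_nat_def [simp del]

section \<open>The series of path volumes\<close>

definition sec_plus_tan :: "real fps" where
  "sec_plus_tan = (1 + fps_sin 1) / fps_cos 1"

text \<open>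
  The \<open>z\<^sup>k\<close>-coefficient is the volume \<open>v\<^sub>k(t)\<close> of the part \<open>x k \<le> t\<close> of the polytope of the path on
  \<open>{1..k}\<close>: integrating over the last coordinate gives \<open>v\<^sub>k\<^sub>+\<^sub>1'(t) = v\<^sub>k(1 - t)\<close>, \<open>v\<^sub>k\<^sub>+\<^sub>1(0) = 0\<close>,
  and this series, \<open>cos(tz) + (sec z + tan z) sin(tz)\<close>, solves that system.
\<close>

definition path_fps :: "real \<Rightarrow> real fps" where
  "path_fps t = fps_cos t + sec_plus_tan * fps_sin t"

text \<open>\<open>fps_cos 1\<close> has constant coefficient 1, so it is a unit and the quotient is
  exact. Multiplied by \<open>fps_cos 1\<close>, the second equation reduces to cos^2 + (1 + sin)
  sin = 1 + sin.\<close>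

lemma sec_plus_tan_eqs:
  "fps_cos 1 * sec_plus_tan = 1 + fps_sin 1"
  "fps_cos 1 + sec_plus_tan * fps_sin 1 = sec_plus_tan"
proof -
  have unit: "fps_cos (1::real) dvd 1 + fps_sin 1"
    by (rule dvd_trans[of _ 1]) (auto simp: fps_is_unit_iff)
  then show eq1: "fps_cos 1 * sec_plus_tan = 1 + fps_sin 1"
    unfolding sec_plus_tan_def by (rule dvd_mult_div_cancel)
  have sq: "fps_cos (1::real) * fps_cos 1 = 1 - fps_sin 1 * fps_sin 1"
    using fps_sin_cos_sum_of_squares[of "1::real"] by (simp add: power2_eq_square algebra_simps)
  have "fps_cos 1 * (fps_cos 1 + sec_plus_tan * fps_sin 1) =
        fps_cos 1 * fps_cos 1 + (fps_cos 1 * sec_plus_tan) * fps_sin 1"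
    by (simp add: algebra_simps)
  also have "\<dots> = 1 + fps_sin 1"
    unfolding eq1 sq by (simp add: algebra_simps)
  also have "\<dots> = fps_cos 1 * sec_plus_tan"
    by (simp add: eq1)
  finally show "fps_cos 1 + sec_plus_tan * fps_sin 1 = sec_plus_tan"
    by (subst (asm) mult_cancel_left) (auto simp: fps_eq_iff dest: spec[of _ 0])
qed

lemma path_fps_0 [simp]: "path_fps 0 = 1"
  by (simp add: path_fps_def)

lemma path_fps_1: "path_fps 1 = sec_plus_tan"
  by (simp add: path_fps_def sec_plus_tan_eqs)

lemma path_fps_nth_0 [simp]: "path_fps t $ 0 = 1"
  by (simp add: path_fps_def)

text \<open>After the addition theorems, \<open>sec_plus_tan_eqs\<close> collapses the two brackets
  to \<open>sec_plus_tan\<close> and -1. The right-hand side is the t-derivative of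
  \<open>path_fps t\<close> with one factor of the series variable removed.\<close>

lemma path_fps_reflect: "path_fps (1 - t) = sec_plus_tan * fps_cos t - fps_sin t"
proof -
  have "path_fps (1 - t) = fps_cos 1 * fps_cos t + fps_sin 1 * fps_sin t
        + sec_plus_tan * (fps_sin 1 * fps_cos t - fps_cos 1 * fps_sin t)"
    using fps_cos_add[of 1 "-t"] fps_sin_add[of 1 "-t"]
    by (simp add: path_fps_def fps_sin_even fps_cos_odd)
  also have "\<dots> = (fps_cos 1 + sec_plus_tan * fps_sin 1) * fps_cos t
        + (fps_sin 1 - fps_cos 1 * sec_plus_tan) * fps_sin t"
    by (simp add: algebra_simps)
  finally show ?thesis
    by (simp add: sec_plus_tan_eqs)
qed

lemma DERIV_power_divide_fact:
  "((\<lambda>t::real. c * t ^ Suc k / fact (Suc k)) has_real_derivative c * t ^ k / fact k) (at t)"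
proof -
  have "((\<lambda>t::real. c * t ^ Suc k / fact (Suc k)) has_real_derivative
      c * (real (Suc k) * t ^ k) / fact (Suc k)) (at t)"
    by (rule DERIV_cdivide[OF DERIV_cmult]) (use DERIV_pow[of "Suc k" t] in simp)
  also have "c * (real (Suc k) * t ^ k) / fact (Suc k) = c * t ^ k / fact k"
    by (simp del: of_nat_Suc)
  finally show ?thesis .
qed

text \<open>Coefficientwise form of d/dt cos(tz) = -z sin(tz); the factor z is the index shift. For
  even \<open>k\<close> both coefficients vanish.\<close>

lemma DERIV_fps_cos_nth: "((\<lambda>t::real. fps_cos t $ Suc k) has_real_derivative - (fps_sin t $ k)) (at t)"
proof (cases "even k")
  case False
  then have "(-1::real) ^ (Suc k div 2) = - ((-1) ^ ((k - 1) div 2))"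
    by (auto elim!: oddE)
  with False DERIV_power_divide_fact[of "(-1) ^ (Suc k div 2)" k t] show ?thesis
    by (simp add: fps_cos_def fps_sin_def del: fact_Suc)
qed (simp add: fps_cos_def fps_sin_def)

lemma DERIV_fps_sin_nth: "((\<lambda>t::real. fps_sin t $ Suc k) has_real_derivative fps_cos t $ k) (at t)"
  using DERIV_power_divide_fact[of "(-1) ^ (k div 2)" k t]
  by (cases "even k") (simp_all add: fps_cos_def fps_sin_def del: fact_Suc)

lemma DERIV_path_fps_nth:
  "((\<lambda>t. path_fps t $ Suc k) has_real_derivative path_fps (1 - t) $ k) (at t)"
proof -
  have "((\<lambda>t. path_fps t $ Suc k) has_real_derivative
      - (fps_sin t $ k) + (\<Sum>i=0..k. sec_plus_tan $ i * fps_cos t $ (k - i))) (at t)"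
    unfolding path_fps_def fps_add_nth fps_mult_nth
  proof (rule DERIV_add[OF DERIV_fps_cos_nth])
    \<comment> \<open>The term \<open>i = Suc k\<close> of the convolution drops out because
      \<open>fps_sin t\<close> has constant coefficient 0.\<close>
    have "((\<lambda>t. \<Sum>i=0..k. sec_plus_tan $ i * fps_sin t $ Suc (k - i)) has_real_derivative
        (\<Sum>i=0..k. sec_plus_tan $ i * fps_cos t $ (k - i))) (at t)"
      by (intro DERIV_sum DERIV_cmult DERIV_fps_sin_nth)
    then show "((\<lambda>t. \<Sum>i=0..Suc k. sec_plus_tan $ i * fps_sin t $ (Suc k - i)) has_real_derivative
        (\<Sum>i=0..k. sec_plus_tan $ i * fps_cos t $ (k - i))) (at t)"
      by (simp add: Suc_diff_le)
  qed
  then show ?thesis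
    by (simp add: path_fps_reflect fps_mult_nth)
qed

text \<open>Each coefficient of positive index is 0 at \<open>t = 0\<close> and has derivative
  \<open>path_fps (1 - s) $ k\<close>, nonnegative by induction since reflection preserves [0, 1].
  This allows passing between \<open>ennreal\<close> and real values.\<close>

lemma path_fps_nth_nonneg: "0 \<le> t \<Longrightarrow> t \<le> 1 \<Longrightarrow> 0 \<le> path_fps t $ k"
proof (induction k arbitrary: t)
  case (Suc k)
  have "\<exists>y. ((\<lambda>t. path_fps t $ Suc k) has_real_derivative y) (at s) \<and> 0 \<le> y"
    if "0 \<le> s" "s \<le> t" for s
    using that Suc.prems by (intro exI[of _ "path_fps (1 - s) $ k"] conjI DERIV_path_fps_nth Suc.IH) auto
  then have "path_fps 0 $ Suc k \<le> path_fps t $ Suc k"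
    by (rule DERIV_nonneg_imp_nondecreasing[OF Suc.prems(1)])
  then show ?case by simp
qed simp

lemma borel_measurable_path_fps_nth [measurable]: "(\<lambda>t. path_fps t $ k) \<in> borel_measurable borel"
proof (cases k)
  case (Suc j)
  then show ?thesis
    by (auto intro!: borel_measurable_continuous_onI continuous_at_imp_continuous_on
        DERIV_isCont[OF DERIV_path_fps_nth])
qed simp

section \<open>Lebesgue measure on finite powers of the real line\<close>

interpretation lborel_PiM: product_sigma_finite "\<lambda>_::nat. lborel :: real measure"
  by unfold_locales

abbreviation lebn :: "nat set \<Rightarrow> (nat \<Rightarrow> real) measure" where
  "lebn I \<equiv> Pi\<^sub>M I (\<lambda>_. lborel)"

lemma measurable_lebn_component [measurable]: "i \<in> I \<Longrightarrow> (\<lambda>x. x i) \<in> borel_measurable (lebn I)"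
  using measurable_component_singleton[of i I "\<lambda>_. lborel :: real measure"] by simp

lemma nn_integral_lebn_Suc:
  assumes "f \<in> borel_measurable (lebn {1..Suc k})"
  shows "integral\<^sup>N (lebn {1..Suc k}) f = (\<integral>\<^sup>+y. \<integral>\<^sup>+x. f (x(Suc k := y)) \<partial>lebn {1..k} \<partial>lborel)"
proof -
  have "{1..Suc k} = insert (Suc k) {1..k}" by auto
  with assms show ?thesis
    by (simp add: lborel_PiM.product_nn_integral_insert_rev)
qed

lemma measurable_lebn_map:
  assumes "p permutes I" "\<And>i. i \<in> I \<Longrightarrow> f i \<in> borel_measurable borel"
  shows "(\<lambda>x. \<lambda>i\<in>I. f i (x (p i))) \<in> lebn I \<rightarrow>\<^sub>M lebn I"
proof (rule measurable_restrict)
  fix i assume i: "i \<in> I"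
  then have "(\<lambda>x. x (p i)) \<in> borel_measurable (lebn I)"
    using permutes_in_image[OF assms(1)] by simp
  from measurable_compose[OF this assms(2)[OF i]]
  show "(\<lambda>x. f i (x (p i))) \<in> lebn I \<rightarrow>\<^sub>M lborel" by simp
qed

text \<open>A finite product of sigma-finite measures is determined on boxes. The preimage of a box
  is a box whose sides are moved by \<open>inv p\<close>; each \<open>f i\<close> preserves the
  measure of its side, so the products agree after reindexing.\<close>

lemma distr_lebn:
  assumes "finite I" "p permutes I"
    and f: "\<And>i. i \<in> I \<Longrightarrow> f i \<in> borel_measurable borel"
    and distr_f: "\<And>i. i \<in> I \<Longrightarrow> distr lborel borel (f i) = lborel"
  shows "distr (lebn I) (lebn I) (\<lambda>x. \<lambda>i\<in>I. f i (x (p i))) = lebn I"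
proof (rule lborel_PiM.PiM_eqI[OF \<open>finite I\<close>])
  let ?T = "\<lambda>x. \<lambda>i\<in>I. f i (x (p i))"
  note [measurable] = measurable_lebn_map[OF assms(2,3)]
  fix A :: "nat \<Rightarrow> real set" assume A: "\<And>i. i \<in> I \<Longrightarrow> A i \<in> sets lborel"
  let ?q = "inv p"
  have q: "?q permutes I"
    by (rule permutes_inv[OF assms(2)])
  have pre: "f i -` A i \<in> sets lborel" "emeasure lborel (f i -` A i) = emeasure lborel (A i)"
    if "i \<in> I" for i
  proof -
    have "f i -` A i \<inter> space borel \<in> sets borel"
      using measurable_sets[OF f[OF that], of "A i"] A[OF that] by simp
    then show "f i -` A i \<in> sets lborel" by simp
    have "emeasure lborel (A i) = emeasure (distr lborel borel (f i)) (A i)"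
      using distr_f[OF that] by simp
    also have "\<dots> = emeasure lborel (f i -` A i)"
      using f[OF that] A[OF that] by (subst emeasure_distr) auto
    finally show "emeasure lborel (f i -` A i) = emeasure lborel (A i)" by simp
  qed
  have "emeasure (distr (lebn I) (lebn I) ?T) (Pi\<^sub>E I A) =
      emeasure (lebn I) (?T -` Pi\<^sub>E I A \<inter> space (lebn I))"
    using A \<open>finite I\<close> by (intro emeasure_distr sets_PiM_I_finite) auto
  also have "?T -` Pi\<^sub>E I A \<inter> space (lebn I) = Pi\<^sub>E I (\<lambda>j. f (?q j) -` A (?q j))" (is "?L = ?R")
  proof (intro equalityI subsetI)
    fix x assume x: "x \<in> ?L"
    have "f (?q j) (x j) \<in> A (?q j)" if "j \<in> I" for j
    proof -
      have "?q j \<in> I"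
        using that permutes_in_image[OF q] by simp
      then show ?thesis
        using x permutes_inverses(1)[OF assms(2), of j] by (auto simp: PiE_iff)
    qed
    then show "x \<in> ?R"
      using x by (auto simp: space_PiM PiE_iff)
  next
    fix x assume x: "x \<in> ?R"
    have "f i (x (p i)) \<in> A i" if "i \<in> I" for i
    proof -
      have "p i \<in> I"
        using that permutes_in_image[OF assms(2)] by simp
      then show ?thesis
        using x permutes_inverses(2)[OF assms(2), of i] by (auto simp: PiE_iff)
    qed
    then show "x \<in> ?L"
      using x by (auto simp: space_PiM PiE_iff)
  qed
  also have "emeasure (lebn I) ?R = (\<Prod>j\<in>I. emeasure lborel (f (?q j) -` A (?q j)))"
    using pre(1) permutes_in_image[OF q] \<open>finite I\<close>
    by (intro lborel_PiM.emeasure_PiM) auto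
  also have "\<dots> = (\<Prod>j\<in>I. emeasure lborel (A (?q j)))"
    using pre(2) permutes_in_image[OF q] by (intro prod.cong) auto
  also have "\<dots> = (\<Prod>i\<in>I. emeasure lborel (A i))"
    using prod.permute[OF q, of "\<lambda>i. emeasure lborel (A i)"] by (simp add: o_def)
  finally show "emeasure (distr (lebn I) (lebn I) ?T) (Pi\<^sub>E I A) = (\<Prod>i\<in>I. emeasure lborel (A i))" .
qed simp

text \<open>The form in which reflections, permutations and rotations of the coordinates are
  applied: \<open>A\<close> is recognised as the preimage of \<open>B\<close> by comparing
  membership pointwise.\<close>

lemma emeasure_lebn_vimage:
  assumes "finite I" "p permutes I"
    and "\<And>i. i \<in> I \<Longrightarrow> f i \<in> borel_measurable borel"
    and "\<And>i. i \<in> I \<Longrightarrow> distr lborel borel (f i) = lborel"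
    and B: "B \<in> sets (lebn I)"
    and AB: "\<And>x. x \<in> extensional I \<Longrightarrow> x \<in> A \<longleftrightarrow> (\<lambda>i\<in>I. f i (x (p i))) \<in> B"
    and A: "A \<subseteq> extensional I"
  shows "emeasure (lebn I) A = emeasure (lebn I) B"
proof -
  let ?T = "\<lambda>x. \<lambda>i\<in>I. f i (x (p i))"
  note T = measurable_lebn_map[OF assms(2,3)]
  have "emeasure (lebn I) B = emeasure (lebn I) (?T -` B \<inter> space (lebn I))"
    using emeasure_distr[OF T B] distr_lebn[OF assms(1-4)] by simp
  also have "?T -` B \<inter> space (lebn I) = A"
    using A AB by (auto simp: space_PiM PiE_def)
  finally show ?thesis by simp
qed

text \<open>Fubini with coordinate \<open>i\<close> innermost: once the other coordinates are fixed,
  only the single value \<open>x j\<close> is left for it, a null set.\<close>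

lemma AE_lebn_neq:
  assumes "finite I" "i \<in> I" "j \<in> I" "i \<noteq> j"
  shows "AE x in lebn I. x i \<noteq> x j"
proof -
  let ?N = "{x \<in> space (lebn I). x i = x j}"
  have N: "?N \<in> sets (lebn I)"
    using assms by measurable
  have I: "insert i (I - {i}) = I"
    using assms by auto
  have "emeasure (lebn I) ?N = (\<integral>\<^sup>+x. \<integral>\<^sup>+y. indicator ?N (x(i := y)) \<partial>lborel \<partial>lebn (I - {i}))"
    using lborel_PiM.product_nn_integral_insert[of "I - {i}" i "indicator ?N"] assms N
    by (simp only: I) simp
  also have "\<dots> = (\<integral>\<^sup>+x. 0 \<partial>lebn (I - {i}))"
  proof (rule nn_integral_cong)
    fix x :: "nat \<Rightarrow> real"
    have "(\<integral>\<^sup>+y. indicator ?N (x(i := y)) \<partial>lborel) \<le> (\<integral>\<^sup>+y. indicator {x j} y \<partial>lborel)"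
      using assms by (intro nn_integral_mono) (auto simp: indicator_def)
    then show "(\<integral>\<^sup>+y. indicator ?N (x(i := y)) \<partial>lborel) = 0"
      by simp
  qed
  finally show ?thesis
    using N by (intro AE_I[of _ _ ?N]) auto
qed

lemma AE_lebn_inj_on:
  assumes "finite I"
  shows "AE x in lebn I. inj_on x I"
proof -
  have "AE x in lebn I. \<forall>i\<in>I. \<forall>j\<in>I. i \<noteq> j \<longrightarrow> x i \<noteq> x j"
    using AE_lebn_neq[OF assms] assms
    by (auto simp: AE_finite_all AE_ball_countable countable_finite intro!: AE_impI)
  then show ?thesis
    by (rule AE_mp) (auto simp: inj_on_def)
qed

lemma sets_lebn_cube: "finite I \<Longrightarrow> I \<rightarrow>\<^sub>E {0..1} \<in> sets (lebn I)"
  by (rule sets_PiM_I_finite) auto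

lemma sets_lebn_cube_Collect:
  assumes "finite I" "Measurable.pred (lebn I) P"
  shows "{x \<in> I \<rightarrow>\<^sub>E {0..1}. P x} \<in> sets (lebn I)"
proof -
  have "{x \<in> I \<rightarrow>\<^sub>E {0..1}. P x} = (I \<rightarrow>\<^sub>E {0..1}) \<inter> {x \<in> space (lebn I). P x}"
    using sets.sets_into_space[OF sets_lebn_cube[OF assms(1)]] by blast
  with predE[OF assms(2)] sets_lebn_cube[OF assms(1)] show ?thesis
    by (simp only: sets.Int)
qed

lemma emeasure_lebn_cube: "finite I \<Longrightarrow> emeasure (lebn I) (I \<rightarrow>\<^sub>E {0..1}) = 1"
  by (subst lborel_PiM.emeasure_PiM) auto

section \<open>Path polytopes\<close>

text \<open>
  For \<open>m = 0\<close> and \<open>t = 1\<close> this is the polytope of the path on \<open>{1..k}\<close>. The slices \<open>m > 0\<close> are scaled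
  copies of it by \<open>1 - 2 * m\<close>; carrying \<open>m\<close> through the recursion avoids a scaling law for product
  measures.
\<close>

definition path_slice :: "nat \<Rightarrow> real \<Rightarrow> real \<Rightarrow> (nat \<Rightarrow> real) set" where
  "path_slice k m t = {x \<in> {1..k} \<rightarrow>\<^sub>E {m..1 - m}.
     (\<forall>i\<in>{1..<k}. x i + x (Suc i) \<le> 1) \<and> (0 < k \<longrightarrow> x k \<le> t)}"

lemma sets_path_slice [measurable]: "path_slice k m t \<in> sets (lebn {1..k})"
proof -
  have "path_slice k m t = {x \<in> space (lebn {1..k}). (\<forall>i\<in>{1..k}. m \<le> x i \<and> x i \<le> 1 - m) \<and>
     (\<forall>i\<in>{1..<k}. x i + x (Suc i) \<le> 1) \<and> (k \<in> {1..k} \<longrightarrow> x k \<le> t)}"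
    by (auto simp: path_slice_def space_PiM PiE_iff)
  also have "\<dots> \<in> sets (lebn {1..k})"
  proof -
    have "Measurable.pred (lebn {1..k}) (\<lambda>x. k \<in> {1..k} \<longrightarrow> x k \<le> t)"
      by (cases "k \<in> {1..k}") simp_all
    moreover have "Measurable.pred (lebn {1..k}) (\<lambda>x. \<forall>i\<in>{1..k}. m \<le> x i \<and> x i \<le> 1 - m)"
      by (rule pred_intros_finite(3)) auto
    moreover have "Measurable.pred (lebn {1..k}) (\<lambda>x. \<forall>i\<in>{1..<k}. x i + x (Suc i) \<le> 1)"
      by (rule pred_intros_finite(3)) auto
    ultimately show ?thesis
      by (intro sets.sets_Collect_conj) (rule predE; assumption)+
  qed
  finally show ?thesis .
qed

text \<open>The edge between \<open>k\<close> and \<open>Suc k\<close> turns into the cap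
  \<open>1 - y\<close> on coordinate \<open>k\<close>, which is why slices carry a cap. By
  \<open>t \<le> 1 - m\<close>, a \<open>y\<close> below \<open>t\<close> also obeys the upper bound
  of the box.\<close>

lemma path_slice_Suc:
  assumes "t \<le> 1 - m" "x \<in> extensional {1..k}"
  shows "x(Suc k := y) \<in> path_slice (Suc k) m t \<longleftrightarrow> y \<in> {m..t} \<and> x \<in> path_slice k m (1 - y)"
proof -
  have 1: "(\<forall>i\<in>{1..<Suc k}. (x(Suc k := y)) i + (x(Suc k := y)) (Suc i) \<le> 1) \<longleftrightarrow>
        (\<forall>i\<in>{1..<k}. x i + x (Suc i) \<le> 1) \<and> (0 < k \<longrightarrow> x k \<le> 1 - y)"
    by (cases k) (auto simp: less_Suc_eq)
  have 2: "x(Suc k := y) \<in> {1..Suc k} \<rightarrow>\<^sub>E {m..1 - m} \<longleftrightarrow>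
        y \<in> {m..1 - m} \<and> x \<in> {1..k} \<rightarrow>\<^sub>E {m..1 - m}"
    using assms(2) by (auto simp: PiE_iff extensional_def le_Suc_eq)
  show ?thesis
    unfolding path_slice_def mem_Collect_eq 1 2 using assms(1) by auto
qed

text \<open>The substitution x = m + (1 - 2m) u explains the formula: x + x' \<le> 1 becomes u + u'
  \<le> 1, and the cap becomes (t - m) / (1 - 2m). The proof integrates over the last coordinate and
  matches the recursion \<open>DERIV_path_fps_nth\<close>.\<close>

lemma emeasure_path_slice:
  assumes "m < 1/2" "m \<le> t" "t \<le> 1 - m"
  shows "emeasure (lebn {1..k}) (path_slice k m t) =
    ennreal ((1 - 2 * m) ^ k * path_fps ((t - m) / (1 - 2 * m)) $ k)"
  using assms(2,3)
proof (induction k arbitrary: t)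
  case 0
  have "path_slice 0 m t = {\<lambda>_. undefined}"
    by (auto simp: path_slice_def)
  then show ?case
    by (simp add: PiM_empty)
next
  case (Suc k)
  let ?c = "1 - 2 * m"
  let ?F = "\<lambda>s. ?c ^ Suc k * path_fps ((s - m) / ?c) $ Suc k"
  let ?f = "\<lambda>s. ?c ^ k * path_fps (1 - (s - m) / ?c) $ k"
  have c: "?c > 0" "2 * m \<noteq> 1" using assms(1) by simp_all
  \<comment> \<open>In the rescaled variable the new cap \<open>1 - s\<close> is the reflection of
    \<open>s\<close>.\<close>
  have refl: "(1 - s - m) / ?c = 1 - (s - m) / ?c" for s
    using c by (simp add: field_simps)
  have "emeasure (lebn {1..Suc k}) (path_slice (Suc k) m t) =
    (\<integral>\<^sup>+y. \<integral>\<^sup>+x. indicator (path_slice (Suc k) m t) (x(Suc k := y)) \<partial>lebn {1..k} \<partial>lborel)"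
    by (subst nn_integral_lebn_Suc[symmetric])
       (simp_all only: borel_measurable_indicator nn_integral_indicator sets_path_slice)
  also have "\<dots> = (\<integral>\<^sup>+y. indicator {m..t} y *
        (\<integral>\<^sup>+x. indicator (path_slice k m (1 - y)) x \<partial>lebn {1..k}) \<partial>lborel)"
  proof (rule nn_integral_cong)
    fix y :: real
    have "(\<integral>\<^sup>+x. indicator (path_slice (Suc k) m t) (x(Suc k := y)) \<partial>lebn {1..k}) =
      (\<integral>\<^sup>+x. indicator {m..t} y * indicator (path_slice k m (1 - y)) x \<partial>lebn {1..k})"
    proof (rule nn_integral_cong)
      fix x assume "x \<in> space (lebn {1..k})"
      then have "x \<in> extensional {1..k}"
        by (auto simp: space_PiM PiE_def)
      from path_slice_Suc[OF Suc.prems(2) this, of y]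
      show "indicator (path_slice (Suc k) m t) (x(Suc k := y)) =
          (indicator {m..t} y * indicator (path_slice k m (1 - y)) x :: ennreal)"
        by (simp add: indicator_def)
    qed
    also have "\<dots> = indicator {m..t} y * (\<integral>\<^sup>+x. indicator (path_slice k m (1 - y)) x \<partial>lebn {1..k})"
      by (rule nn_integral_cmult[OF borel_measurable_indicator[OF sets_path_slice]])
    finally show "(\<integral>\<^sup>+x. indicator (path_slice (Suc k) m t) (x(Suc k := y)) \<partial>lebn {1..k}) =
      indicator {m..t} y * (\<integral>\<^sup>+x. indicator (path_slice k m (1 - y)) x \<partial>lebn {1..k})" .
  qed
  also have "\<dots> = (\<integral>\<^sup>+y. ennreal (?f y) * indicator {m..t} y \<partial>lborel)"
  proof (rule nn_integral_cong)
    fix y :: real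
    show "indicator {m..t} y * (\<integral>\<^sup>+x. indicator (path_slice k m (1 - y)) x \<partial>lebn {1..k}) =
        ennreal (?f y) * indicator {m..t} y"
      unfolding nn_integral_indicator[OF sets_path_slice]
      using Suc.IH[of "1 - y"] Suc.prems refl[of y] by (cases "y \<in> {m..t}") auto
  qed
  \<comment> \<open>The chain rule factor \<open>1 / ?c\<close> uses up one power of
    \<open>?c\<close>. The lower boundary term \<open>?F m\<close> is 0, since
    \<open>path_fps 0 = 1\<close>.\<close>
  also have "\<dots> = ennreal (?F t - ?F m)"
  proof (rule nn_integral_FTC_Icc)
    show "(?F has_real_derivative ?f s) (at s)" for s
    proof -
      have "((\<lambda>s. path_fps ((s - m) / ?c) $ Suc k) has_real_derivative
          path_fps (1 - (s - m) / ?c) $ k * (1 / ?c)) (at s)"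
        by (rule DERIV_chain2[OF DERIV_path_fps_nth]) (use c in \<open>auto intro!: derivative_eq_intros\<close>)
      moreover have "?c ^ Suc k * (r * (1 / ?c)) = ?c ^ k * r" for r
        using c by simp
      ultimately show ?thesis
        by (metis DERIV_cmult)
    qed
    show "0 \<le> ?f s" if "s \<in> {m..t}" for s
      using that Suc.prems c by (intro mult_nonneg_nonneg path_fps_nth_nonneg) (auto simp: field_simps)
    show "?f \<in> borel_measurable borel"
      by measurable
  qed (use Suc.prems in simp)
  finally show ?case by simp
qed

section \<open>Alternating permutations\<close>

lemma distr_lborel_reflect: "distr lborel borel (\<lambda>x::real. 1 - x) = lborel"
  using lborel_real_affine[of "-1" 1] by (simp add: density_1)

text \<open>Replacing \<open>x i\<close> by \<open>1 - x i\<close> for even \<open>i\<close> turns the path inequalities into alternating ones.\<close>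

definition alternating_cube :: "nat \<Rightarrow> (nat \<Rightarrow> real) set" where
  "alternating_cube n = {x \<in> {1..n} \<rightarrow>\<^sub>E {0..1}.
     \<forall>i\<in>{1..<n}. if odd i then x i \<le> x (Suc i) else x (Suc i) \<le> x i}"

lemma emeasure_alternating_cube_eq_path:
  "emeasure (lebn {1..n}) (alternating_cube n) = emeasure (lebn {1..n}) (path_slice n 0 1)"
proof (rule emeasure_lebn_vimage[where p = id and f = "\<lambda>i x. if even i then 1 - x else x"])
  let ?f = "\<lambda>i x::real. if even i then 1 - x else x"
  show "?f i \<in> borel_measurable borel" for i :: nat
    by measurable
  show "distr lborel borel (?f i) = lborel" for i :: nat
    by (cases "even i") (simp_all add: distr_lborel_reflect distr_id2)
  fix x :: "nat \<Rightarrow> real" assume x: "x \<in> extensional {1..n}"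
  let ?y = "\<lambda>i\<in>{1..n}. ?f i (x (id i))"
  have 1: "?y \<in> {1..n} \<rightarrow>\<^sub>E {0..1} \<longleftrightarrow> x \<in> {1..n} \<rightarrow>\<^sub>E {0..1}"
    using x by (auto simp: PiE_iff)
  \<comment> \<open>Exactly one of \<open>i\<close> and \<open>Suc i\<close> is even, so one summand
    is reflected and the 1 cancels.\<close>
  have 2: "?y i + ?y (Suc i) \<le> 1 \<longleftrightarrow> (if odd i then x i \<le> x (Suc i) else x (Suc i) \<le> x i)"
    if "i \<in> {1..<n}" for i
    using that by auto
  have 3: "0 < n \<longrightarrow> ?y n \<le> 1" if "?y \<in> {1..n} \<rightarrow>\<^sub>E {0..1}"
    using that by (auto simp: PiE_iff)
  show "x \<in> alternating_cube n \<longleftrightarrow> ?y \<in> path_slice n 0 1"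
    unfolding alternating_cube_def path_slice_def mem_Collect_eq
    using 1 2 3 by (auto simp only: diff_zero)
qed (auto simp: alternating_cube_def PiE_def permutes_id)

text \<open>With the weak inequality \<open>i\<close> counts itself, so the ranks of an injective
  \<open>x\<close> on \<open>{1..n}\<close> run through exactly \<open>{1..n}\<close>.\<close>

definition rank_on :: "nat set \<Rightarrow> (nat \<Rightarrow> real) \<Rightarrow> nat \<Rightarrow> nat" where
  "rank_on I x i = card {j \<in> I. x j \<le> x i}"

text \<open>Sublevel sets grow with the level; if \<open>x i < x j\<close>, the larger one gains at
  least \<open>j\<close>.\<close>

lemma rank_on_less_iff:
  assumes "finite I" "i \<in> I" "j \<in> I"
  shows "rank_on I x i < rank_on I x j \<longleftrightarrow> x i < x j"
proof -
  have less: "rank_on I x k < rank_on I x l" if "x k < x l" "l \<in> I" for k l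
    unfolding rank_on_def using that assms(1) by (intro psubset_card_mono) force+
  have le: "rank_on I x k \<le> rank_on I x l" if "x k \<le> x l" for k l
    unfolding rank_on_def using that assms(1) by (intro card_mono) force+
  show ?thesis
    using less[of i j] le[of j i] assms(3) by linarith
qed

lemma rank_on_permutes:
  fixes x :: "nat \<Rightarrow> real"
  assumes "inj_on x {1..n}"
  shows "(\<lambda>i. if i \<in> {1..n} then rank_on {1..n} x i else i) permutes {1..n}"
proof (rule bij_imp_permutes)
  let ?r = "\<lambda>i. if i \<in> {1..n} then rank_on {1..n} x i else i"
  have inj: "inj_on ?r {1..n}"
  proof (rule inj_onI)
    fix i j assume ij: "i \<in> {1..n}" "j \<in> {1..n}" "?r i = ?r j"
    then have "\<not> x i < x j" "\<not> x j < x i"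
      using rank_on_less_iff[of "{1..n}" i j x] rank_on_less_iff[of "{1..n}" j i x] by auto
    then have "x i = x j" by simp
    with ij assms show "i = j" by (auto dest: inj_onD)
  qed
  have "?r i \<in> {1..n}" if "i \<in> {1..n}" for i
  proof -
    have "0 < rank_on {1..n} x i"
      unfolding rank_on_def card_gt_0_iff using that by auto
    moreover have "rank_on {1..n} x i \<le> card {1..n}"
      unfolding rank_on_def by (rule card_mono) auto
    ultimately show ?thesis
      using that by auto
  qed
  then have "?r ` {1..n} \<subseteq> {1..n}" by blast
  with inj show "bij_betw ?r {1..n} {1..n}"
    unfolding bij_betw_def using endo_inj_surj[of "{1..n}" ?r] by blast
qed auto

text \<open>The injective map \<open>p\<close> carries the sublevel set of the permuted point onto
  that of \<open>x\<close>, preserving its cardinality.\<close>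

lemma rank_on_permute:
  assumes "p permutes I" "i \<in> I"
  shows "rank_on I (\<lambda>j\<in>I. x (p j)) i = rank_on I x (p i)"
proof -
  have "{l \<in> I. x l \<le> x (p i)} = p ` {j \<in> I. x (p j) \<le> x (p i)}"
    using permutes_image[OF assms(1)] by auto
  moreover have "inj_on p A" for A
    using permutes_inj[OF assms(1)] by (rule inj_on_subset) simp
  ultimately have "card {l \<in> I. x l \<le> x (p i)} = card {j \<in> I. x (p j) \<le> x (p i)}"
    by (simp add: card_image)
  also have "{j \<in> I. x (p j) \<le> x (p i)} =
      {j \<in> I. (\<lambda>j\<in>I. x (p j)) j \<le> (\<lambda>j\<in>I. x (p j)) i}"
    using assms(2) by auto
  finally show ?thesis
    by (simp add: rank_on_def)
qed

text \<open>For a permutation \<open>a\<close> this is the order simplex with strict inequalities.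
  Prescribing exact ranks makes the cells of different permutations disjoint, and points with ties
  lie in none of them.\<close>

definition rank_cell :: "nat \<Rightarrow> (nat \<Rightarrow> nat) \<Rightarrow> (nat \<Rightarrow> real) set" where
  "rank_cell n a = {x \<in> {1..n} \<rightarrow>\<^sub>E {0..1}. \<forall>i\<in>{1..n}. rank_on {1..n} x i = a i}"

lemma sets_rank_cell: "rank_cell n a \<in> sets (lebn {1..n})"
proof -
  let ?M = "lebn {1..n}"
  have "Measurable.pred ?M (\<lambda>x. \<forall>i\<in>{1..n}. rank_on {1..n} x i = a i)"
  proof (rule pred_intros_finite(3))
    fix i assume i: "i \<in> {1..n}"
    note [measurable] = measurable_lebn_component[OF i]
    have "{x \<in> space ?M. j \<in> {j \<in> {1..n}. x j \<le> x i}} \<in> sets ?M" for j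
    proof (cases "j \<in> {1..n}")
      case True
      note [measurable] = measurable_lebn_component[OF this]
      have "{x \<in> space ?M. x j \<le> x i} \<in> sets ?M"
        by measurable
      with True show ?thesis by simp
    qed (simp del: atLeastAtMost_iff)
    then have [measurable]: "(\<lambda>x. rank_on {1..n} x i) \<in> ?M \<rightarrow>\<^sub>M count_space UNIV"
      unfolding rank_on_def by (rule measurable_card[where S = "\<lambda>x. {j \<in> {1..n}. x j \<le> x i}"])
    show "Measurable.pred ?M (\<lambda>x. rank_on {1..n} x i = a i)"
      by (rule pred_count_space_const1) measurable
  qed simp
  then show ?thesis
    unfolding rank_cell_def by (intro sets_lebn_cube_Collect) simp_all
qed

text \<open>If coordinate \<open>i\<close> of \<open>x\<close> has rank \<open>i\<close> for all
  \<open>i\<close>, then coordinate \<open>i\<close> of the point permuted by \<open>a\<close> has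
  rank \<open>a i\<close>; so permuting coordinates matches the two cells.\<close>

lemma emeasure_rank_cell:
  assumes "a permutes {1..n}"
  shows "emeasure (lebn {1..n}) (rank_cell n a) = emeasure (lebn {1..n}) (rank_cell n id)"
proof (rule emeasure_lebn_vimage[symmetric, where p = a and f = "\<lambda>_ x. x"])
  fix x :: "nat \<Rightarrow> real" assume x: "x \<in> extensional {1..n}"
  let ?I = "{1..n}"
  have a: "a ` ?I = ?I"
    by (rule permutes_image[OF assms])
  \<comment> \<open>Both conditions are stated over the image of \<open>?I\<close> under
    \<open>a\<close>, so that \<open>a\<close> disappears on rewriting this image to
    \<open>?I\<close>.\<close>
  have 1: "(\<lambda>i\<in>?I. x (a i)) \<in> ?I \<rightarrow>\<^sub>E {0..1} \<longleftrightarrow> (\<forall>i\<in>a ` ?I. x i \<in> {0..1})"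
    by (auto simp: PiE_iff)
  have 2: "(\<forall>i\<in>?I. rank_on ?I (\<lambda>i\<in>?I. x (a i)) i = a i) \<longleftrightarrow> (\<forall>i\<in>a ` ?I. rank_on ?I x i = i)"
    using rank_on_permute[OF assms] by auto
  show "x \<in> rank_cell n id \<longleftrightarrow> (\<lambda>i\<in>?I. x (a i)) \<in> rank_cell n a"
    unfolding rank_cell_def mem_Collect_eq 1 2 a using x by (auto simp: PiE_iff)
next
  show "rank_cell n id \<subseteq> extensional {1..n}"
    by (auto simp: rank_cell_def PiE_def)
qed (use assms in \<open>auto simp: sets_rank_cell distr_id2\<close>)

lemma emeasure_UN_rank_cell:
  assumes "P \<subseteq> {a. a permutes {1..n}}"
  shows "emeasure (lebn {1..n}) (\<Union>a\<in>P. rank_cell n a) =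
    of_nat (card P) * emeasure (lebn {1..n}) (rank_cell n id)"
proof -
  have fin: "finite P"
    using assms finite_permutations[of "{1..n}"] by (auto intro: finite_subset)
  \<comment> \<open>The ranks of a common point fix both permutations on \<open>{1..n}\<close>;
    elsewhere both are the identity.\<close>
  have "a = b" if "a \<in> P" "b \<in> P" "x \<in> rank_cell n a" "x \<in> rank_cell n b" for a b x
  proof
    fix i show "a i = b i"
    proof (cases "i \<in> {1..n}")
      case True
      then show ?thesis
        using that(3,4) by (simp add: rank_cell_def)
    next
      case False
      moreover have "a permutes {1..n}" "b permutes {1..n}"
        using that(1,2) assms by auto
      ultimately show ?thesis
        by (metis permutes_not_in)
    qed
  qed
  then have "disjoint_family_on (rank_cell n) P"
    unfolding disjoint_family_on_def by blast
  then have "emeasure (lebn {1..n}) (\<Union>a\<in>P. rank_cell n a) =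
      (\<Sum>a\<in>P. emeasure (lebn {1..n}) (rank_cell n a))"
    using fin sets_rank_cell by (intro sum_emeasure[symmetric]) auto
  also have "\<dots> = (\<Sum>a\<in>P. emeasure (lebn {1..n}) (rank_cell n id))"
    using assms by (intro sum.cong emeasure_rank_cell) auto
  finally show ?thesis by simp
qed

lemma sets_UN_rank_cell:
  assumes "P \<subseteq> {a. a permutes {1..n}}"
  shows "(\<Union>a\<in>P. rank_cell n a) \<in> sets (lebn {1..n})"
  using assms finite_permutations[of "{1..n}"] sets_rank_cell
  by (intro sets.finite_UN) (auto intro: finite_subset)

lemma rank_permutation_exists:
  fixes x :: "nat \<Rightarrow> real"
  assumes "inj_on x {1..n}"
  obtains a where "a permutes {1..n}" "\<And>i. i \<in> {1..n} \<Longrightarrow> a i = rank_on {1..n} x i"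
  using rank_on_permutes[OF assms] by (rule that) simp

text \<open>Up to ties, the n! cells of equal volume fill the unit cube.\<close>

lemma emeasure_rank_cell_id:
  "of_nat (fact n) * emeasure (lebn {1..n}) (rank_cell n id) = 1"
proof -
  let ?P = "{a. a permutes {1..n}}"
  have "1 = emeasure (lebn {1..n}) ({1..n} \<rightarrow>\<^sub>E {0..1})"
    by (simp add: emeasure_lebn_cube)
  also have "\<dots> = emeasure (lebn {1..n}) (\<Union>a\<in>?P. rank_cell n a)"
  proof (rule emeasure_eq_AE)
    show "AE x in lebn {1..n}. x \<in> {1..n} \<rightarrow>\<^sub>E {0..1} \<longleftrightarrow> x \<in> (\<Union>a\<in>?P. rank_cell n a)"
      using AE_lebn_inj_on[of "{1..n}", OF finite_atLeastAtMost]
    proof (rule AE_mp, intro AE_I2 impI)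
      fix x :: "nat \<Rightarrow> real" assume "inj_on x {1..n}"
      then obtain a where "a permutes {1..n}" "\<And>i. i \<in> {1..n} \<Longrightarrow> a i = rank_on {1..n} x i"
        by (rule rank_permutation_exists) blast
      then show "x \<in> {1..n} \<rightarrow>\<^sub>E {0..1} \<longleftrightarrow> x \<in> (\<Union>a\<in>?P. rank_cell n a)"
        unfolding rank_cell_def by force
    qed
  qed (auto intro: sets_lebn_cube sets_UN_rank_cell)
  also have "\<dots> = of_nat (card ?P) * emeasure (lebn {1..n}) (rank_cell n id)"
    by (rule emeasure_UN_rank_cell) simp
  finally show ?thesis
    by (simp add: card_permutations)
qed

lemma sets_alternating_cube: "alternating_cube n \<in> sets (lebn {1..n})"
proof -
  let ?M = "lebn {1..n}"
  have "Measurable.pred ?M (\<lambda>x. \<forall>i\<in>{1..<n}. if odd i then x i \<le> x (Suc i) else x (Suc i) \<le> x i)"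
  proof (rule pred_intros_finite(3))
    fix i assume i: "i \<in> {1..<n}"
    then have *: "(\<lambda>x. x i) \<in> borel_measurable ?M" "(\<lambda>x. x (Suc i)) \<in> borel_measurable ?M"
      by (auto intro!: measurable_lebn_component)
    have "Measurable.pred ?M (\<lambda>x. x i \<le> x (Suc i))" "Measurable.pred ?M (\<lambda>x. x (Suc i) \<le> x i)"
      unfolding pred_def using * by (auto intro!: borel_measurable_le)
    then show "Measurable.pred ?M (\<lambda>x. if odd i then x i \<le> x (Suc i) else x (Suc i) \<le> x i)"
      by (cases "odd i") simp_all
  qed simp
  then show ?thesis
    unfolding alternating_cube_def by (intro sets_lebn_cube_Collect) simp_all
qed

text \<open>Away from ties, \<open>x\<close> alternates exactly when its rank permutation does. So
  the set is, up to a null set, the disjoint union of the cells of alternating permutations, each of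
  volume 1/n!.\<close>

lemma emeasure_alternating_cube:
  "emeasure (lebn {1..n}) (alternating_cube n) = ennreal (euler_zigzag n / fact n)"
proof -
  let ?P = "{a. a permutes {1..n} \<and>
       (\<forall>i\<in>{1..<n}. if odd i then a i < a (i + 1) else a i > a (i + 1))}"
  let ?c = "emeasure (lebn {1..n}) (rank_cell n id)"
  have "emeasure (lebn {1..n}) (alternating_cube n) =
      emeasure (lebn {1..n}) (\<Union>a\<in>?P. rank_cell n a)"
  proof (rule emeasure_eq_AE)
    show "AE x in lebn {1..n}. x \<in> alternating_cube n \<longleftrightarrow> x \<in> (\<Union>a\<in>?P. rank_cell n a)"
      using AE_lebn_inj_on[of "{1..n}", OF finite_atLeastAtMost]
    proof (rule AE_mp, intro AE_I2 impI)
      fix x :: "nat \<Rightarrow> real" assume inj: "inj_on x {1..n}"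
      then obtain a where a: "a permutes {1..n}" "\<And>i. i \<in> {1..n} \<Longrightarrow> a i = rank_on {1..n} x i"
        by (rule rank_permutation_exists) blast
      \<comment> \<open>Kept general in \<open>b\<close>: it serves the rank permutation
        \<open>a\<close> and also the permutation of an arbitrary cell containing
        \<open>x\<close>.\<close>
      have less: "x i < x j \<longleftrightarrow> b i < b j"
        if "\<And>i. i \<in> {1..n} \<Longrightarrow> rank_on {1..n} x i = b i" "i \<in> {1..n}" "j \<in> {1..n}" for b i j
        using rank_on_less_iff[of "{1..n}" i j x] that by simp
      have neq: "x i \<noteq> x (Suc i)" if "i \<in> {1..<n}" for i
        using inj_onD[OF inj, of i "Suc i"] that by auto
      show "x \<in> alternating_cube n \<longleftrightarrow> x \<in> (\<Union>a\<in>?P. rank_cell n a)"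
      proof
        assume x: "x \<in> alternating_cube n"
        have "if odd i then a i < a (i + 1) else a i > a (i + 1)" if i: "i \<in> {1..<n}" for i
        proof -
          have "if odd i then x i < x (Suc i) else x (Suc i) < x i"
            using x i neq[OF i] unfolding alternating_cube_def
            by (smt (verit, best) mem_Collect_eq)
          with i show ?thesis
            using less[of a i "Suc i"] less[of a "Suc i" i] a(2) by (auto simp: Suc_eq_plus1[symmetric])
        qed
        with a(1) have "a \<in> ?P" by blast
        moreover have "x \<in> rank_cell n a"
          using x a(2) by (simp add: alternating_cube_def rank_cell_def)
        ultimately show "x \<in> (\<Union>a\<in>?P. rank_cell n a)" by blast
      next
        assume "x \<in> (\<Union>a\<in>?P. rank_cell n a)"
        then obtain b where b: "b \<in> ?P" "x \<in> rank_cell n b" by blast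
        have "if odd i then x i \<le> x (Suc i) else x (Suc i) \<le> x i" if i: "i \<in> {1..<n}" for i
        proof -
          have "if odd i then b i < b (Suc i) else b i > b (Suc i)"
            using b(1) i unfolding Suc_eq_plus1 by blast
          with i b(2) show ?thesis
            using less[of b i "Suc i"] less[of b "Suc i" i] by (auto simp: rank_cell_def)
        qed
        with b(2) show "x \<in> alternating_cube n"
          unfolding alternating_cube_def rank_cell_def by blast
      qed
    qed
  qed (auto intro: sets_alternating_cube sets_UN_rank_cell)
  also have "\<dots> = of_nat (euler_zigzag n) * ?c"
    unfolding euler_zigzag_def by (rule emeasure_UN_rank_cell) auto
  also have "?c = ennreal (1 / fact n)"
  proof -
    \<comment> \<open>This equation forces \<open>?c\<close> to be finite, after which n! can be
      divided off in the reals.\<close>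
    have c: "of_nat (fact n) * ?c = 1"
      by (rule emeasure_rank_cell_id)
    then have "?c \<noteq> \<infinity>"
      by (auto simp: ennreal_mult_top)
    then obtain r where r: "r \<ge> 0" "?c = ennreal r"
      by (cases ?c) auto
    have "ennreal (fact n * r) = ennreal (real (fact n)) * ennreal r"
      using r(1) by (simp add: ennreal_mult)
    also have "\<dots> = 1"
      using c unfolding r(2) ennreal_of_nat_eq_real_of_nat .
    finally have "fact n * r = 1"
      by (simp add: ennreal_eq_1)
    then have "r = 1 / fact n"
      by (simp add: field_simps)
    with r(2) show ?thesis by simp
  qed
  also have "of_nat (euler_zigzag n) * ennreal (1 / fact n) = ennreal (euler_zigzag n / fact n)"
    by (simp add: ennreal_of_nat_eq_real_of_nat flip: ennreal_mult)
  finally show ?thesis .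
qed

text \<open>Andre's theorem, obtained by computing the volume of the path polytope in two ways: by
  the recursion and by counting order simplices.\<close>

lemma sec_plus_tan_nth: "sec_plus_tan $ n = euler_zigzag n / fact n"
proof -
  have "ennreal (euler_zigzag n / fact n) = ennreal (sec_plus_tan $ n)"
    using emeasure_alternating_cube[of n] emeasure_path_slice[of 0 1 n]
    unfolding emeasure_alternating_cube_eq_path by (simp add: path_fps_1)
  moreover have "0 \<le> sec_plus_tan $ n"
    using path_fps_nth_nonneg[of 1 n] by (simp add: path_fps_1)
  ultimately show ?thesis
    by simp
qed

section \<open>Cycle polytopes\<close>

definition cycle_succ :: "nat \<Rightarrow> nat \<Rightarrow> nat" where
  "cycle_succ n i = (if i = n then 1 else Suc i)"

definition cycle_min_cell :: "nat \<Rightarrow> nat \<Rightarrow> (nat \<Rightarrow> real) set" where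
  "cycle_min_cell n k = {x \<in> graph_polytope {1..n} (cycle_edges n). \<forall>j\<in>{1..n}. x k \<le> x j}"

lemma mem_cycle_min_cell:
  "x \<in> cycle_min_cell n k \<longleftrightarrow> x \<in> {1..n} \<rightarrow>\<^sub>E {0..1} \<and>
     (\<forall>i\<in>{1..n}. x i + x (cycle_succ n i) \<le> 1) \<and> (\<forall>j\<in>{1..n}. x k \<le> x j)"
  unfolding cycle_min_cell_def graph_polytope_cycle cycle_succ_def Suc_eq_plus1 by blast

lemma sets_cycle_min_cell:
  assumes "k \<in> {1..n}"
  shows "cycle_min_cell n k \<in> sets (lebn {1..n})"
proof -
  let ?M = "lebn {1..n}"
  have "Measurable.pred ?M (\<lambda>x. \<forall>j\<in>{1..n}. x k \<le> x j)"
  proof (rule pred_intros_finite(3))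
    fix j assume "j \<in> {1..n}"
    note [measurable] = assms[THEN measurable_lebn_component] this[THEN measurable_lebn_component]
    show "Measurable.pred ?M (\<lambda>x. x k \<le> x j)"
      unfolding pred_def by measurable
  qed simp
  then have "{x \<in> space ?M. \<forall>j\<in>{1..n}. x k \<le> x j} \<in> sets ?M"
    by (rule predE)
  moreover have G: "graph_polytope {1..n} (cycle_edges n) \<in> sets ?M"
    by (rule sets_graph_polytope) simp
  moreover have "cycle_min_cell n k = graph_polytope {1..n} (cycle_edges n) \<inter>
      {x \<in> space ?M. \<forall>j\<in>{1..n}. x k \<le> x j}"
    unfolding cycle_min_cell_def using sets.sets_into_space[OF G] by blast
  ultimately show ?thesis
    by (simp only: sets.Int)
qed

text \<open>If the last coordinate \<open>y\<close> is minimal, the successor of any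
  \<open>j\<close> has value at least \<open>y\<close>, so \<open>x j \<le> 1 - y\<close>.
  Conversely these bounds imply the edge inequalities at the last vertex, leaving only those of the
  path.\<close>

lemma cycle_min_cell_last:
  assumes "x \<in> extensional {1..k}"
  shows "x(Suc k := y) \<in> cycle_min_cell (Suc k) (Suc k) \<longleftrightarrow>
    y \<in> {0..1/2} \<and> x \<in> path_slice k y (1 - y)" (is "?z \<in> _ \<longleftrightarrow> ?R")
proof
  assume "?z \<in> cycle_min_cell (Suc k) (Suc k)"
  then have z: "?z \<in> {1..Suc k} \<rightarrow>\<^sub>E {0..1}"
      "\<And>i. i \<in> {1..Suc k} \<Longrightarrow> ?z i + ?z (cycle_succ (Suc k) i) \<le> 1"
      "\<And>j. j \<in> {1..Suc k} \<Longrightarrow> y \<le> ?z j"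
    unfolding mem_cycle_min_cell by auto
  have x: "y \<le> x j \<and> x j \<le> 1 - y" if j: "j \<in> {1..k}" for j
  proof -
    have "y \<le> ?z (cycle_succ (Suc k) j)"
      using j by (intro z(3)) (auto simp: cycle_succ_def)
    moreover have "?z j = x j"
      using j by simp
    ultimately show ?thesis
      using z(2)[of j] z(3)[of j] j by simp
  qed
  have "0 \<le> y"
    using z(1) by (auto simp: PiE_iff dest: bspec[of _ _ "Suc k"])
  \<comment> \<open>Vertex 1 follows \<open>Suc k\<close> on the cycle; for \<open>k = 0\<close> it
    is the same vertex, with its loop.\<close>
  moreover have "y \<le> 1/2"
    using z(2)[of "Suc k"] z(3)[of 1] by (auto simp: cycle_succ_def)
  moreover have "x i + x (Suc i) \<le> 1" if "i \<in> {1..<k}" for i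
    using z(2)[of i] that by (auto simp: cycle_succ_def)
  ultimately show ?R
    using x assms by (auto simp: path_slice_def PiE_iff)
next
  assume R: ?R
  then have x: "\<And>j. j \<in> {1..k} \<Longrightarrow> y \<le> x j \<and> x j \<le> 1 - y"
      "\<And>i. i \<in> {1..<k} \<Longrightarrow> x i + x (Suc i) \<le> 1"
    by (auto simp: path_slice_def PiE_iff)
  have y: "0 \<le> y" "y \<le> 1/2"
    using R by auto
  have z: "y \<le> ?z j \<and> ?z j \<le> 1 - y" if "j \<in> {1..Suc k}" for j
    using x(1)[of j] y that by auto
  have "?z \<in> {1..Suc k} \<rightarrow>\<^sub>E {0..1}"
    unfolding PiE_iff
  proof
    show "\<forall>i\<in>{1..Suc k}. ?z i \<in> {0..1}"
      using z y by force
    show "?z \<in> extensional {1..Suc k}"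
      using assms by (auto simp: extensional_def)
  qed
  moreover have "?z i + ?z (cycle_succ (Suc k) i) \<le> 1" if i: "i \<in> {1..Suc k}" for i
  proof -
    consider "i = Suc k" | "i = k" "1 \<le> k" | "i \<in> {1..<k}"
      using i by (cases "i = Suc k"; cases "i = k") auto
    then show ?thesis
    proof cases
      case 1
      then show ?thesis
        using z[of 1] by (simp add: cycle_succ_def)
    next
      case 2
      then show ?thesis
        using z[of k] by (simp add: cycle_succ_def)
    next
      case 3
      then show ?thesis
        using x(2)[of i] by (simp add: cycle_succ_def)
    qed
  qed
  ultimately show "?z \<in> cycle_min_cell (Suc k) (Suc k)"
    unfolding mem_cycle_min_cell using z by simp
qed

text \<open>The slice at height y has volume (1 - 2y)^k times that of the path polytope. The
  antiderivative \<open>?F\<close> vanishes at 1/2, so the integral is \<open>- ?c\<close>.\<close>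

lemma emeasure_cycle_min_cell_last:
  "emeasure (lebn {1..Suc k}) (cycle_min_cell (Suc k) (Suc k)) =
    ennreal (sec_plus_tan $ k / (2 * real (Suc k)))"
proof -
  let ?a = "sec_plus_tan $ k"
  let ?c = "- (?a / (2 * real (Suc k)))"
  let ?F = "\<lambda>y. ?c * (1 - 2 * y) ^ Suc k"
  let ?f = "\<lambda>y. (1 - 2 * y) ^ k * ?a"
  have a: "0 \<le> ?a"
    using path_fps_nth_nonneg[of 1 k] by (simp add: path_fps_1)
  have S: "cycle_min_cell (Suc k) (Suc k) \<in> sets (lebn {1..Suc k})"
    by (rule sets_cycle_min_cell) simp
  have "emeasure (lebn {1..Suc k}) (cycle_min_cell (Suc k) (Suc k)) =
    (\<integral>\<^sup>+y. \<integral>\<^sup>+x. indicator (cycle_min_cell (Suc k) (Suc k)) (x(Suc k := y)) \<partial>lebn {1..k} \<partial>lborel)"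
    by (subst nn_integral_lebn_Suc[symmetric])
       (simp_all only: borel_measurable_indicator nn_integral_indicator S)
  also have "\<dots> = (\<integral>\<^sup>+y. ennreal (?f y) * indicator {0..1/2} y \<partial>lborel)"
  \<comment> \<open>The point 1/2 is discarded because the slice formula divides by 1 - 2y.\<close>
  proof (rule nn_integral_cong_AE, rule AE_mp[OF AE_lborel_singleton[of "1/2"]], intro AE_I2 impI)
    fix y :: real assume y: "y \<noteq> 1/2"
    have "(\<integral>\<^sup>+x. indicator (cycle_min_cell (Suc k) (Suc k)) (x(Suc k := y)) \<partial>lebn {1..k}) =
      (\<integral>\<^sup>+x. indicator {0..1/2} y * indicator (path_slice k y (1 - y)) x \<partial>lebn {1..k})"
    proof (rule nn_integral_cong)
      fix x assume "x \<in> space (lebn {1..k})"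
      then have "x \<in> extensional {1..k}"
        by (auto simp: space_PiM PiE_def)
      from cycle_min_cell_last[OF this, of y]
      show "indicator (cycle_min_cell (Suc k) (Suc k)) (x(Suc k := y)) =
          (indicator {0..1/2} y * indicator (path_slice k y (1 - y)) x :: ennreal)"
        by (simp add: indicator_def)
    qed
    also have "\<dots> = indicator {0..1/2} y * emeasure (lebn {1..k}) (path_slice k y (1 - y))"
      unfolding nn_integral_cmult[OF borel_measurable_indicator[OF sets_path_slice]]
        nn_integral_indicator[OF sets_path_slice] ..
    also have "\<dots> = ennreal (?f y) * indicator {0..1/2} y"
    proof (cases "y \<in> {0..1/2}")
      case True
      with y have "y < 1/2" by simp
      moreover from this have "(1 - y - y) / (1 - 2 * y) = 1" by simp
      ultimately show ?thesis
        using True emeasure_path_slice[of y "1 - y" k] by (simp add: path_fps_1)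
    qed simp
    finally show "(\<integral>\<^sup>+x. indicator (cycle_min_cell (Suc k) (Suc k)) (x(Suc k := y)) \<partial>lebn {1..k}) =
      ennreal (?f y) * indicator {0..1/2} y" .
  qed
  also have "\<dots> = ennreal (?F (1/2) - ?F 0)"
  proof (rule nn_integral_FTC_Icc)
    show "?f \<in> borel_measurable borel"
      by measurable
    show "(?F has_real_derivative ?f y) (at y)" for y
    proof -
      have "((\<lambda>y. (1 - 2 * y) ^ Suc k) has_real_derivative (1 + of_nat k) * (- 2 * (1 - 2 * y) ^ k)) (at y)"
        by (rule DERIV_power_Suc) (auto intro!: derivative_eq_intros)
      from DERIV_cmult[OF this, of ?c]
      show ?thesis
        by (rule DERIV_cong) (simp add: field_simps)
    qed
    show "0 \<le> ?f y" if "y \<in> {0..1/2}" for y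
      using a that by simp
  qed simp
  finally show ?thesis by simp
qed

lemma cycle_rotation_permutes:
  "(\<lambda>i. if i \<in> {1..n} then cycle_succ n i else i) permutes {1..n}" (is "?p permutes _")
proof (rule bij_imp_permutes)
  have "inj_on ?p {1..n}"
    by (auto simp: inj_on_def cycle_succ_def split: if_splits)
  moreover have "?p ` {1..n} \<subseteq> {1..n}"
    by (auto simp: cycle_succ_def)
  ultimately show "bij_betw ?p {1..n} {1..n}"
    unfolding bij_betw_def using endo_inj_surj[of "{1..n}" ?p] by blast
qed auto

text \<open>Rotation is an automorphism of the cycle: the rotated point has value
  \<open>x (cycle_succ n i)\<close> at \<open>i\<close>, so its minimum sits at \<open>k\<close>
  exactly when that of \<open>x\<close> sits at \<open>cycle_succ n k\<close>.\<close>

lemma emeasure_cycle_min_cell_succ: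
  assumes k: "k \<in> {1..n}"
  shows "emeasure (lebn {1..n}) (cycle_min_cell n (cycle_succ n k)) =
    emeasure (lebn {1..n}) (cycle_min_cell n k)"
proof (rule emeasure_lebn_vimage[OF _ cycle_rotation_permutes, where f = "\<lambda>_ x. x"])
  fix x :: "nat \<Rightarrow> real" assume x: "x \<in> extensional {1..n}"
  let ?I = "{1..n}" and ?s = "cycle_succ n"
  have "?s ` ?I = (\<lambda>i. if i \<in> ?I then ?s i else i) ` ?I"
    by (rule image_cong) auto
  then have s: "?s ` ?I = ?I"
    using permutes_image[OF cycle_rotation_permutes[of n]] by simp
  then have sI: "?s i \<in> ?I" if "i \<in> ?I" for i
    using that by blast
  have eq: "(\<lambda>i\<in>?I. x (if i \<in> ?I then ?s i else i)) = (\<lambda>i\<in>?I. x (?s i))" (is "?y = ?z")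
    by auto
  have 1: "?z \<in> ?I \<rightarrow>\<^sub>E {0..1} \<longleftrightarrow> (\<forall>i\<in>?s ` ?I. x i \<in> {0..1})"
    by (auto simp: PiE_iff)
  have 2: "(\<forall>i\<in>?I. ?z i + ?z (?s i) \<le> 1) \<longleftrightarrow> (\<forall>i\<in>?s ` ?I. x i + x (?s i) \<le> 1)"
    using sI by simp
  have 3: "(\<forall>j\<in>?I. ?z k \<le> ?z j) \<longleftrightarrow> (\<forall>j\<in>?s ` ?I. x (?s k) \<le> x j)"
    using k by simp
  show "x \<in> cycle_min_cell n (?s k) \<longleftrightarrow> ?y \<in> cycle_min_cell n k"
    unfolding eq mem_cycle_min_cell 1 2 3 s using x by (auto simp: PiE_iff)
next
  show "cycle_min_cell n (cycle_succ n k) \<subseteq> extensional {1..n}"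
    by (auto simp: mem_cycle_min_cell PiE_def)
qed (simp_all add: distr_id2 sets_cycle_min_cell[OF k])

lemma emeasure_cycle_min_cell:
  assumes "k \<in> {1..n}"
  shows "emeasure (lebn {1..n}) (cycle_min_cell n k) = ennreal (sec_plus_tan $ (n - 1) / (2 * real n))"
proof -
  \<comment> \<open>All cells are compared with that of vertex 1; the instance \<open>k = n\<close>
    then links them to the last cell, whose volume is known.\<close>
  have first: "emeasure (lebn {1..n}) (cycle_min_cell n k) = emeasure (lebn {1..n}) (cycle_min_cell n 1)"
    if "1 \<le> k" "k \<le> n" for k
    using that
  proof (induction k rule: dec_induct)
    case (step k)
    then show ?case
      using emeasure_cycle_min_cell_succ[of k n] by (simp add: cycle_succ_def)
  qed simp
  obtain m where n: "n = Suc m"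
    using assms by (cases n) auto
  show ?thesis
    using first[of k] first[of n] emeasure_cycle_min_cell_last[of m] assms by (simp add: n)
qed

text \<open>Every point has a minimal coordinate, so the cells cover the polytope. Two of them meet
  only where two coordinates coincide, a null set, and the \<open>n\<close> equal volumes add
  up.\<close>

lemma graph_vol_cycle:
  assumes "n \<ge> 1"
  shows "graph_vol {1..n} (cycle_edges n) = sec_plus_tan $ (n - 1) / 2"
proof -
  let ?M = "lebn {1..n}"
  have nonneg: "0 \<le> sec_plus_tan $ (n - 1)"
    using path_fps_nth_nonneg[of 1 "n - 1"] by (simp add: path_fps_1)
  have "graph_polytope {1..n} (cycle_edges n) = (\<Union>k\<in>{1..n}. cycle_min_cell n k)"
  proof (intro equalityI subsetI)
    fix x assume x: "x \<in> graph_polytope {1..n} (cycle_edges n)"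
    obtain k where k: "k \<in> {1..n}" "x k = Min (x ` {1..n})"
      using Min_in[of "x ` {1..n}"] assms by fastforce
    then have "\<forall>j\<in>{1..n}. x k \<le> x j"
      by simp
    with x k(1) show "x \<in> (\<Union>k\<in>{1..n}. cycle_min_cell n k)"
      unfolding cycle_min_cell_def by blast
  qed (auto simp: cycle_min_cell_def)
  then have "graph_vol {1..n} (cycle_edges n) = measure ?M (\<Union>k\<in>{1..n}. cycle_min_cell n k)"
    by (simp add: graph_vol_def)
  also have "\<dots> = (\<Sum>k\<in>{1..n}. measure ?M (cycle_min_cell n k))"
  proof (rule measure_UNION_AE)
    show "cycle_min_cell n k \<in> fmeasurable ?M" if "k \<in> {1..n}" for k
      using emeasure_cycle_min_cell[OF that] by (intro fmeasurableI sets_cycle_min_cell that) simp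
    show "pairwise (\<lambda>i j. AE x in ?M. x \<notin> cycle_min_cell n i \<or> x \<notin> cycle_min_cell n j) {1..n}"
    proof (rule pairwiseI)
      fix i j assume ij: "i \<in> {1..n}" "j \<in> {1..n}" "i \<noteq> j"
      then have "AE x in ?M. x i \<noteq> x j"
        by (intro AE_lebn_neq) auto
      then show "AE x in ?M. x \<notin> cycle_min_cell n i \<or> x \<notin> cycle_min_cell n j"
        by (rule AE_mp) (use ij in \<open>auto simp: cycle_min_cell_def intro!: AE_I2 antisym\<close>)
    qed
  qed simp
  also have "\<dots> = (\<Sum>k\<in>{1..n}. sec_plus_tan $ (n - 1) / (2 * real n))"
    using emeasure_cycle_min_cell nonneg by (intro sum.cong) (auto simp: measure_def)
  also have "\<dots> = sec_plus_tan $ (n - 1) / 2"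
    using assms by simp
  finally show ?thesis .
qed

section \<open>The generating function\<close>

lemma sec_plus_tan_has_fps_expansion:
  "(\<lambda>x. 1 / cos x + tan x) has_fps_expansion sec_plus_tan"
proof -
  have "(\<lambda>x::real. (1 + sin x) / cos x) has_fps_expansion sec_plus_tan"
    unfolding sec_plus_tan_def
    by (intro has_fps_expansion_divide' fps_expansion_intros) auto
  then show ?thesis
    by (simp add: tan_def add_divide_distrib)
qed

theorem corollary2p5:
  shows "(\<forall>n\<ge>1. graph_vol {1..n} (cycle_edges n) =
            real (euler_zigzag (n - 1)) / (2 * fact (n - 1))) \<and>
         (\<lambda>x::real. x * (1 / cos x + tan x) / 2) has_fps_expansion
            Abs_fps (\<lambda>n. if n = 0 then 0 else graph_vol {1..n} (cycle_edges n))"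
proof (intro conjI allI impI)
  show "graph_vol {1..n} (cycle_edges n) = real (euler_zigzag (n - 1)) / (2 * fact (n - 1))"
    if "n \<ge> 1" for n
    using graph_vol_cycle[OF that] by (simp add: sec_plus_tan_nth)
  \<comment> \<open>Multiplication by \<open>fps_X\<close> accounts for the shift from
    \<open>n - 1\<close> to \<open>n\<close> and for the zero constant coefficient.\<close>
  have "Abs_fps (\<lambda>n. if n = 0 then 0 else graph_vol {1..n} (cycle_edges n)) =
      fps_const (1 / 2) * (fps_X * sec_plus_tan)"
    by (rule fps_ext) (simp add: graph_vol_cycle)
  moreover have "(\<lambda>x::real. 1 / 2 * (x * (1 / cos x + tan x))) has_fps_expansion
      fps_const (1 / 2) * (fps_X * sec_plus_tan)"
    by (intro has_fps_expansion_cmult_left has_fps_expansion_mult has_fps_expansion_fps_X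
        sec_plus_tan_has_fps_expansion)
  ultimately show "(\<lambda>x::real. x * (1 / cos x + tan x) / 2) has_fps_expansion
      Abs_fps (\<lambda>n. if n = 0 then 0 else graph_vol {1..n} (cycle_edges n))"
    by simp
qed

end
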